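(* Let $G=P_m\boxtimes P_n$ be a strong grid, where $P_i$ denotes the path with $i$ vertices. Then \[c_{cr}(G)=\begin{cases}4, & \text{if } m,n>3;\\ 3, & \text{if } \min\{m,n\}=2 \text{ or } \min\{m,n\}=3.\end{cases}\]
   Context: The strong product $G\boxtimes H$ has vertex set $\{(g,h): g\in V(G), h\in V(H)\}$, with distinct vertices $(g,h)$ and $(g',h')$ adjacent if $g$ is equal or adjacent to $g'$ and $h$ is equal or adjacent to $h'$. Cheating Robot game on a finite, simple, connected graph $G$ with $k$ cops: first the cop player places $k$ cops on vertices of $G$, then the robot is placed on a vertex. A vertex may hold more than one token. Play then proceeds in rounds: in each round, first every cop moves to a vertex in its closed neighbourhood (so a cop may stay put), and then the robot, knowing the cops' moves, moves to a vertex in his closed neighbourhood (he may stay put). Both sides have perfect information about positions. The robot is captured if either (i) at the end of the robot's move a cop and the robot are on the same vertex, or (ii) on his move the robot traverses an edge that a cop traversed on the cops' immediately preceding move. (A cop moving onto the robot's vertex does not by itself end the game; the robot still gets his move.) The cops win if they capture the robot after finitely many rounds. $c_{cr}(G)$ is the least number of cops that have a strategy guaranteeing capture of the robot on $G$. *)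

theory Defs
  imports "Graph_Theory.Pair_Digraph"
begin

text \<open>
  A finite simple graph is a \<^locale>\<open>pair_graph\<close>: finite, loop-free, and with each edge present in
  both directions.
\<close>

definition path_graph :: "nat \<Rightarrow> nat pair_pre_digraph" where
  "path_graph n = \<lparr> pverts = {..<n},
     parcs = {(a, b). a < n \<and> b < n \<and> (b = Suc a \<or> a = Suc b)} \<rparr>"

definition strong_product ::
    "'a pair_pre_digraph \<Rightarrow> 'b pair_pre_digraph \<Rightarrow> ('a \<times> 'b) pair_pre_digraph" where
  "strong_product G H = \<lparr> pverts = pverts G \<times> pverts H,
     parcs = {((g, h), (g', h')) | g h g' h'.
       g \<in> pverts G \<and> g' \<in> pverts G \<and> h \<in> pverts H \<and> h' \<in> pverts H \<and> (g, h) \<noteq> (g', h') \<and>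
       (g = g' \<or> (g, g') \<in> parcs G) \<and> (h = h' \<or> (h, h') \<in> parcs H)} \<rparr>"

definition closed_nbhd :: "'a pair_pre_digraph \<Rightarrow> 'a \<Rightarrow> 'a set" where
  "closed_nbhd G v = insert v {w. (v, w) \<in> parcs G}"

text \<open>
  The cops are numbered \<open>0, \<dots>, k - 1\<close>. A strategy \<open>\<sigma>\<close> sends the list of robot positions seen so
  far, oldest first, to the cops' next positions: \<open>\<sigma> []\<close> is the initial placement, and
  \<open>\<sigma> [r\<^sub>0, \<dots>, r\<^sub>t]\<close> is where the cops stand after their move in response to \<open>r\<^sub>t\<close>. Earlier cop
  positions need not be an argument, since \<open>\<sigma>\<close> itself determines them from the list.
\<close>

definition cop_strategy :: "'a pair_pre_digraph \<Rightarrow> nat \<Rightarrow> ('a list \<Rightarrow> nat \<Rightarrow> 'a) \<Rightarrow> bool" where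
  "cop_strategy G k \<sigma> \<longleftrightarrow>
     (\<forall>i<k. \<sigma> [] i \<in> pverts G) \<and>
     (\<forall>h r. \<forall>i<k. \<sigma> (h @ [r]) i \<in> closed_nbhd G (\<sigma> h i))"

definition robot_play :: "'a pair_pre_digraph \<Rightarrow> (nat \<Rightarrow> 'a) \<Rightarrow> bool" where
  "robot_play G R \<longleftrightarrow> R 0 \<in> pverts G \<and> (\<forall>t. R (Suc t) \<in> closed_nbhd G (R t))"

text \<open>
  The outcome of a round in which the cops move from \<open>c\<close> to \<open>c'\<close> and then the robot from \<open>r\<close> to
  \<open>r'\<close>. Edges are undirected, so the direction of traversal is irrelevant. Whether \<open>c' i = r\<close> plays no
  role: a cop moving onto the robot does not end the game.
\<close>

definition captured :: "nat \<Rightarrow> (nat \<Rightarrow> 'a) \<Rightarrow> (nat \<Rightarrow> 'a) \<Rightarrow> 'a \<Rightarrow> 'a \<Rightarrow> bool" where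
  "captured k c c' r r' \<longleftrightarrow>
     (\<exists>i<k. c' i = r') \<or> (r \<noteq> r' \<and> (\<exists>i<k. {c i, c' i} = {r, r'}))"

text \<open>
  Round \<open>t\<close>, counted from 0, starts with the robot on \<open>R t\<close> and ends with him on \<open>R (Suc t)\<close>. A play
  is continued formally after a capture; this is harmless as only the existence of a capturing round
  matters.
\<close>

definition winning_cop_strategy ::
    "'a pair_pre_digraph \<Rightarrow> nat \<Rightarrow> ('a list \<Rightarrow> nat \<Rightarrow> 'a) \<Rightarrow> bool" where
  "winning_cop_strategy G k \<sigma> \<longleftrightarrow> cop_strategy G k \<sigma> \<and>
     (\<forall>R. robot_play G R \<longrightarrow>
       (\<exists>t. captured k (\<sigma> (map R [0..<t])) (\<sigma> (map R [0..<Suc t])) (R t) (R (Suc t))))"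

definition c_cr :: "'a pair_pre_digraph \<Rightarrow> nat" where
  "c_cr G = (LEAST k. \<exists>\<sigma>. winning_cop_strategy G k \<sigma>)"

lemma pair_graph_path_graph: "pair_graph (path_graph n)"
proof -
  have "finite (parcs (path_graph n))"
    by (rule finite_subset[of _ "{..<n} \<times> {..<n}"]) (auto simp: path_graph_def)
  then show ?thesis
    by unfold_locales (auto simp: path_graph_def symmetric_def intro!: symI)
qed

lemma pair_graph_strong_product:
  assumes "pair_graph G" and "pair_graph H"
  shows "pair_graph (strong_product G H)"
proof -
  interpret G: pair_graph G by fact
  interpret H: pair_graph H by fact
  have fin: "finite (pverts G \<times> pverts H)"
    using G.pair_finite_verts H.pair_finite_verts by simp
  have "finite (parcs (strong_product G H))"
    by (rule finite_subset[OF _ finite_cartesian_product[OF fin fin]])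
      (auto simp: strong_product_def)
  moreover have "sym (parcs (strong_product G H))"
    using G.sym_arcs H.sym_arcs
    by (auto simp: strong_product_def symmetric_def intro!: symI dest: symD)
  ultimately show ?thesis
    using fin by unfold_locales (auto simp: strong_product_def symmetric_def)
qed

text \<open>On a finite graph some number of cops wins, so the minimum in \<^const>\<open>c_cr\<close> is attained.\<close>

lemma ex_winning_cop_strategy:
  assumes "pair_graph G"
  shows "\<exists>k \<sigma>. winning_cop_strategy G k \<sigma>"
proof -
  interpret pair_graph G by fact
  obtain f where f: "bij_betw f {..<card (pverts G)} (pverts G)"
    using ex_bij_betw_nat_finite[OF pair_finite_verts] by (auto simp: atLeast0LessThan)
  have "winning_cop_strategy G (card (pverts G)) (\<lambda>_. f)"
    unfolding winning_cop_strategy_def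
  proof (intro conjI allI impI)
    show "cop_strategy G (card (pverts G)) (\<lambda>_. f)"
      using bij_betwE[OF f] by (auto simp: cop_strategy_def closed_nbhd_def)
  next
    fix R assume R: "robot_play G R"
    then have "R (Suc 0) \<in> pverts G"
      using in_arcsD2 unfolding robot_play_def closed_nbhd_def by (metis insertE mem_Collect_eq)
    then obtain i where "i < card (pverts G)" "f i = R (Suc 0)"
      using bij_betw_imp_surj_on[OF f] by (metis imageE lessThan_iff)
    then show "\<exists>t. captured (card (pverts G)) f f (R t) (R (Suc t))"
      unfolding captured_def by blast
  qed
  then show ?thesis by blast
qed

end

theory Submission
  imports Defs
begin

text \<open>
  \<^bold>\<open>Lower bounds.\<close> Against \<open>k\<close> cops the robot, standing on \<open>r\<close>, finds at most \<open>k + 1\<close> vertices of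
  his closed neighbourhood unsafe: \<open>r\<close> itself, and one more for each cop (the vertex she came from
  if she moved onto \<open>r\<close>, and the vertex she moved to otherwise). So the robot survives for ever
  inside any set \<open>S\<close> in which every closed neighbourhood has more than \<open>k + 1\<close> elements
  (\<open>no_winning_cop_strategy\<close>). If \<open>m, n \<ge> 2\<close>, the set of all vertices defeats two cops; if
  \<open>m, n \<ge> 4\<close>, the set of all vertices but the four corners defeats three.

  \<^bold>\<open>Upper bounds.\<close> The cops may pretend to stand on arbitrary points of the integer plane and to
  move there like chess kings, the robot being confined to the board: projecting their positions
  onto the nearest points of the board keeps moves legal and preserves captures
  (\<open>grid_strategy\<close>). This removes all boundary cases, and lets the cops start outside the board.

  On a board of width at most 3, three cops form a line across the board and push it forward
  (\<open>three_cops_win\<close>). If the robot keeps away from the line, the whole line advances. If he stands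
  in front of its middle, the middle cop jumps onto him, which also closes the edge behind her and
  forces him to move; if he stands in front of an end of the line, one cop jumps onto him and the
  other two close all exits except the forward ones. In each case the line is complete again, one
  step further, shortly afterwards.

  On an arbitrary board, three cops in a horizontal line of length 3, kept centred below the
  robot, prevent him from crossing their row, and climb whenever he is not in the row just above
  them (\<open>four_cops_win\<close>). While he stays in that row, the fourth cop enters it on his left and then
  moves right in every round. The robot cannot slip past her: when she jumps onto him from the
  left, both his vertex and the edge to the left are closed. Hence he runs out of room on the right,
  and has to move up or is captured.
\<close>

section \<open>Strategies from invariants\<close>

lemma closed_nbhd_subset_verts:
  assumes "pair_graph G" "v \<in> pverts G" "w \<in> closed_nbhd G v"
  shows "w \<in> pverts G"
proof -
  interpret pair_graph G by fact
  show ?thesis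
    using assms in_arcsD2 unfolding closed_nbhd_def by blast
qed

text \<open>
  The cops carry a state \<open>s\<close> from which their positions \<open>pos s\<close> can be read off. They win if from
  every state in the invariant \<open>I\<close> they have a move after which the robot is either captured or
  in \<open>I\<close> again at a smaller place of a well-founded relation.
\<close>

lemma winning_cop_strategy_from_invariant:
  fixes pos :: "'s \<Rightarrow> nat \<Rightarrow> 'a"
  assumes G: "pair_graph G" and wf: "wf W"
    and start: "\<And>i. i < k \<Longrightarrow> pos s0 i \<in> pverts G" "\<And>r. r \<in> pverts G \<Longrightarrow> I s0 r"
    and step: "\<And>s r. I s r \<Longrightarrow> r \<in> pverts G \<Longrightarrow>
      \<exists>s'. (\<forall>i<k. pos s' i \<in> closed_nbhd G (pos s i)) \<and>
        (\<forall>r'\<in>closed_nbhd G r. captured k (pos s) (pos s') r r' \<or>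
           (I s' r' \<and> ((s', r'), (s, r)) \<in> W))"
  shows "\<exists>\<sigma>. winning_cop_strategy G k \<sigma>"
proof -
  obtain f where f:
    "\<And>s r i. I s r \<Longrightarrow> r \<in> pverts G \<Longrightarrow> i < k \<Longrightarrow> pos (f s r) i \<in> closed_nbhd G (pos s i)"
    "\<And>s r r'. I s r \<Longrightarrow> r \<in> pverts G \<Longrightarrow> r' \<in> closed_nbhd G r \<Longrightarrow>
       captured k (pos s) (pos (f s r)) r r' \<or> (I (f s r) r' \<and> ((f s r, r'), (s, r)) \<in> W)"
    using step by metis
  \<comment> \<open>A strategy must be legal against every list of robot positions, so the cops stay put if \<open>I\<close> fails.\<close>
  define nxt where "nxt s r = (if I s r \<and> r \<in> pverts G then f s r else s)" for s r
  define st where "st h = foldl nxt s0 h" for h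
  have st_simps: "st [] = s0" "st (h @ [r]) = nxt (st h) r" for h r
    by (simp_all add: st_def)
  have "cop_strategy G k (\<lambda>h. pos (st h))"
    unfolding cop_strategy_def st_simps
  proof (intro conjI allI impI)
    show "pos (nxt (st h) r) i \<in> closed_nbhd G (pos (st h) i)" if "i < k" for h r i
      using f(1) that by (simp add: nxt_def) (simp add: closed_nbhd_def)
  qed (rule start(1))
  moreover have
    "\<exists>t. captured k (pos (st (map R [0..<t]))) (pos (st (map R [0..<Suc t]))) (R t) (R (Suc t))"
    if R: "robot_play G R" for R
  proof (rule ccontr)
    assume nc: "\<not> ?thesis"
    define S where "S t = st (map R [0..<t])" for t
    have S_Suc: "S (Suc t) = nxt (S t) (R t)" for t
      by (simp add: S_def st_simps)
    have inv: "I (S t) (R t) \<and> R t \<in> pverts G" for t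
    proof (induction t)
      case 0
      then show ?case using R start(2) by (simp add: S_def st_simps robot_play_def)
    next
      case (Suc t)
      have "R (Suc t) \<in> closed_nbhd G (R t)" using R by (simp add: robot_play_def)
      then show ?case
        using Suc f(2)[of "S t" "R t" "R (Suc t)"] nc closed_nbhd_subset_verts[OF G]
        by (metis S_def S_Suc nxt_def)
    qed
    have "((S (Suc t), R (Suc t)), (S t, R t)) \<in> W" for t
      using f(2)[of "S t" "R t" "R (Suc t)"] nc inv[of t] R
      by (metis S_def S_Suc nxt_def robot_play_def)
    then have "\<exists>F. \<forall>t. (F (Suc t), F t) \<in> W"
      by (intro exI[of _ "\<lambda>t. (S t, R t)"]) simp
    then show False using wf by (simp add: wf_iff_no_infinite_down_chain)
  qed
  ultimately show ?thesis unfolding winning_cop_strategy_def by blast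
qed

section \<open>Kings on the integer plane\<close>

abbreviation strong_grid :: "nat \<Rightarrow> nat \<Rightarrow> (nat \<times> nat) pair_pre_digraph" where
  "strong_grid m n \<equiv> strong_product (path_graph m) (path_graph n)"

text \<open>Two points of the integer plane are at most one move of a chess king apart.\<close>

definition king :: "int \<times> int \<Rightarrow> int \<times> int \<Rightarrow> bool" where
  "king p q \<longleftrightarrow> \<bar>fst p - fst q\<bar> \<le> 1 \<and> \<bar>snd p - snd q\<bar> \<le> 1"

definition board :: "nat \<Rightarrow> nat \<Rightarrow> (int \<times> int) set" where
  "board m n = {0..<int m} \<times> {0..<int n}"

definition to_plane :: "nat \<times> nat \<Rightarrow> int \<times> int" where
  "to_plane v = (int (fst v), int (snd v))"

text \<open>The nearest vertex of the strong grid to a point of the plane.\<close>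

definition to_grid :: "nat \<Rightarrow> nat \<Rightarrow> int \<times> int \<Rightarrow> nat \<times> nat" where
  "to_grid m n p = (nat (min (fst p) (int m - 1)), nat (min (snd p) (int n - 1)))"

lemma pair_graph_strong_grid: "pair_graph (strong_grid m n)"
  by (intro pair_graph_strong_product pair_graph_path_graph)

lemma pverts_path_graph: "pverts (path_graph n) = {..<n}"
  by (simp add: path_graph_def)

lemma pverts_strong_grid: "pverts (strong_grid m n) = {..<m} \<times> {..<n}"
  by (simp add: strong_product_def pverts_path_graph)

lemma to_grid_to_plane: "v \<in> pverts (strong_grid m n) \<Longrightarrow> to_grid m n (to_plane v) = v"
  by (auto simp: pverts_strong_grid to_grid_def to_plane_def min_def)

lemma to_plane_in_board: "to_plane v \<in> board m n \<longleftrightarrow> v \<in> pverts (strong_grid m n)"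
  by (cases v) (auto simp: pverts_strong_grid board_def to_plane_def)

lemma to_grid_in_verts: "m > 0 \<Longrightarrow> n > 0 \<Longrightarrow> to_grid m n p \<in> pverts (strong_grid m n)"
  by (auto simp: pverts_strong_grid to_grid_def)

lemma closed_nbhd_strong_grid:
  assumes "v \<in> pverts (strong_grid m n)"
  shows "w \<in> closed_nbhd (strong_grid m n) v \<longleftrightarrow>
    w \<in> pverts (strong_grid m n) \<and> king (to_plane v) (to_plane w)"
proof (cases v, cases w)
  fix a b c d assume vw: "v = (a, b)" "w = (c, d)"
  have "\<bar>int a - int c\<bar> \<le> 1 \<longleftrightarrow> a = c \<or> c = Suc a \<or> a = Suc c"
    "\<bar>int b - int d\<bar> \<le> 1 \<longleftrightarrow> b = d \<or> d = Suc b \<or> b = Suc d" by auto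
  then show ?thesis using assms
    unfolding vw by (auto simp: closed_nbhd_def king_def to_plane_def strong_product_def path_graph_def)
qed

lemma to_grid_king:
  assumes "m > 0" "n > 0" "king p q"
  shows "to_grid m n q \<in> closed_nbhd (strong_grid m n) (to_grid m n p)"
  unfolding closed_nbhd_strong_grid[OF to_grid_in_verts[OF assms(1,2)]]
  using assms to_grid_in_verts[OF assms(1,2)]
  by (auto simp: king_def to_plane_def to_grid_def min_def abs_if split: if_splits)

text \<open>
  A winning strategy for \<open>k\<close> kings in the plane against a robot who never leaves the board gives a
  winning strategy for \<open>k\<close> cops on the board, because \<^const>\<open>to_grid\<close> is a retraction. A state is
  the list of the positions of the kings.
\<close>

lemma grid_strategy:
  fixes s0 :: "(int \<times> int) list"
  assumes mn: "m > 0" "n > 0" and wf: "wf W"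
    and start: "\<And>r. r \<in> board m n \<Longrightarrow> I s0 r"
    and step: "\<And>s r. I s r \<Longrightarrow> r \<in> board m n \<Longrightarrow>
      \<exists>s'. (\<forall>i<k. king (s ! i) (s' ! i)) \<and>
        (\<forall>r'\<in>board m n. king r r' \<longrightarrow> captured k ((!) s) ((!) s') r r' \<or>
           (I s' r' \<and> ((s', r'), (s, r)) \<in> W))"
  shows "\<exists>\<sigma>. winning_cop_strategy (strong_grid m n) k \<sigma>"
proof (rule winning_cop_strategy_from_invariant[where pos = "\<lambda>s i. to_grid m n (s ! i)"
      and I = "\<lambda>s r. I s (to_plane r)" and ?s0.0 = s0
      and W = "inv_image W (\<lambda>(s, r). (s, to_plane r))"])
  show "pair_graph (strong_grid m n)" by (rule pair_graph_strong_grid)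
  show "wf (inv_image W (\<lambda>(s, r). (s, to_plane r)))" using wf by (rule wf_inv_image)
  show "to_grid m n (s0 ! i) \<in> pverts (strong_grid m n)" for i
    using mn by (rule to_grid_in_verts)
  show "I s0 (to_plane r)" if "r \<in> pverts (strong_grid m n)" for r
    using start that by (simp add: to_plane_in_board)
next
  fix s r assume I: "I s (to_plane r)" and r: "r \<in> pverts (strong_grid m n)"
  then obtain s' where s': "\<forall>i<k. king (s ! i) (s' ! i)"
    "\<forall>r'\<in>board m n. king (to_plane r) r' \<longrightarrow> captured k ((!) s) ((!) s') (to_plane r) r' \<or>
       (I s' r' \<and> ((s', r'), (s, to_plane r)) \<in> W)"
    using step[of s "to_plane r"] by (auto simp: to_plane_in_board)
  have cap: "captured k (\<lambda>i. to_grid m n (s ! i)) (\<lambda>i. to_grid m n (s' ! i)) r r'"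
    if r': "r' \<in> pverts (strong_grid m n)"
      and c: "captured k ((!) s) ((!) s') (to_plane r) (to_plane r')" for r'
  proof -
    have img: "{to_grid m n (s ! i), to_grid m n (s' ! i)} = {r, r'}"
      if "{s ! i, s' ! i} = {to_plane r, to_plane r'}" for i
      using arg_cong[OF that, of "(`) (to_grid m n)"] to_grid_to_plane[OF r] to_grid_to_plane[OF r']
      by simp
    show ?thesis
      using c img to_grid_to_plane[OF r'] unfolding captured_def by metis
  qed
  show "\<exists>s'. (\<forall>i<k. to_grid m n (s' ! i) \<in> closed_nbhd (strong_grid m n) (to_grid m n (s ! i))) \<and>
      (\<forall>r'\<in>closed_nbhd (strong_grid m n) r.
         captured k (\<lambda>i. to_grid m n (s ! i)) (\<lambda>i. to_grid m n (s' ! i)) r r' \<or>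
         I s' (to_plane r') \<and> ((s', r'), s, r) \<in> inv_image W (\<lambda>(s, r). (s, to_plane r)))"
  proof (intro exI[of _ s'] conjI allI impI ballI)
    fix r' assume "r' \<in> closed_nbhd (strong_grid m n) r"
    then have "r' \<in> pverts (strong_grid m n)" "king (to_plane r) (to_plane r')"
      by (simp_all add: closed_nbhd_strong_grid[OF r])
    then show "captured k (\<lambda>i. to_grid m n (s ! i)) (\<lambda>i. to_grid m n (s' ! i)) r r' \<or>
        I s' (to_plane r') \<and> ((s', r'), s, r) \<in> inv_image W (\<lambda>(s, r). (s, to_plane r))"
      using s'(2) cap to_plane_in_board by fastforce
  qed (use s'(1) mn to_grid_king in blast)
qed

lemma all_less_3: "(\<forall>i<3. P i) \<longleftrightarrow> P 0 \<and> P 1 \<and> P (2::nat)"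
  by (auto simp: numeral_eq_Suc less_Suc_eq)

lemma ex_less_3: "(\<exists>i<3. P i) \<longleftrightarrow> P 0 \<or> P 1 \<or> P (2::nat)"
  by (auto simp: numeral_eq_Suc less_Suc_eq)

lemma all_less_4: "(\<forall>i<4. P i) \<longleftrightarrow> P 0 \<and> P 1 \<and> P 2 \<and> P (3::nat)"
  by (auto simp: numeral_eq_Suc less_Suc_eq)

lemma ex_less_4: "(\<exists>i<4. P i) \<longleftrightarrow> P 0 \<or> P 1 \<or> P 2 \<or> P (3::nat)"
  by (auto simp: numeral_eq_Suc less_Suc_eq)

section \<open>Three cops on a board of width at most three\<close>

text \<open>
  The first coordinate runs across the board and the second one numbers the rows. Here \<open>j\<close> is the row
  of the rearmost cops, and the robot is beyond it. The alternatives are: the complete line; the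
  position after the middle cop has jumped; and the two positions after an end cop has jumped, in
  which the cop from the other end stands in the middle of row \<open>j\<close>.
\<close>

definition line_invariant :: "(int \<times> int) list \<Rightarrow> int \<times> int \<Rightarrow> bool" where
  "line_invariant s r \<longleftrightarrow> (\<exists>j. snd r > j \<and>
     (s = [(0, j), (1, j), (2, j)] \<or>
      s = [(0, j), (1, j + 1), (2, j)] \<and> r \<noteq> (1, j + 1) \<or>
      s = [(0, j + 1), (1, j + 1), (1, j)] \<and> snd r > j + 1 \<or>
      s = [(1, j), (1, j + 1), (2, j + 1)] \<and> snd r > j + 1))"

lemma three_cops_win:
  assumes m: "0 < m" "m \<le> 3" and n: "0 < n"
  shows "\<exists>\<sigma>. winning_cop_strategy (strong_grid m n) 3 \<sigma>"
proof -
  \<comment> \<open>No cop ever retreats, and the sum of their rows grows in every round.\<close>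
  define W where "W = measure (\<lambda>(s, r :: int \<times> int).
    nat (3 * int n - sum_list (map snd (s :: (int \<times> int) list))))"
  show ?thesis
  proof (rule grid_strategy[where I = line_invariant and ?s0.0 = "[(0, -1), (1, -1), (2, -1)]" and W = W])
    show "0 < m" "0 < n" by fact+
    show "wf W" by (simp add: W_def)
    show "line_invariant [(0, -1), (1, -1), (2, -1)] r" if "r \<in> board m n" for r
      using that by (auto simp: line_invariant_def board_def intro: exI[of _ "-1"])
  next
    fix s r assume inv: "line_invariant s r" and rb: "r \<in> board m n"
    obtain x y where r: "r = (x, y)" by (cases r)
    have x: "x = 0 \<or> x = 1 \<or> x = 2" and y: "y < int n"
      using rb m unfolding r board_def by auto
    obtain j where j: "y > j" and s:
      "s = [(0, j), (1, j), (2, j)] \<or>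
       s = [(0, j), (1, j + 1), (2, j)] \<and> r \<noteq> (1, j + 1) \<or>
       s = [(0, j + 1), (1, j + 1), (1, j)] \<and> y > j + 1 \<or>
       s = [(1, j), (1, j + 1), (2, j + 1)] \<and> y > j + 1"
      using inv unfolding line_invariant_def r snd_conv by blast
    define s' :: "(int \<times> int) list" where "s' =
      (if y > j + 1 then [(0, j + 1), (1, j + 1), (2, j + 1)]
       else if x = 1 then [(0, j), (1, j + 1), (2, j)]
       else if x = 0 then [(0, j + 1), (1, j + 1), (1, j)]
       else [(1, j), (1, j + 1), (2, j + 1)])"
    have "\<forall>i<3. king (s ! i) (s' ! i)"
      using s x j unfolding r all_less_3 s'_def by (auto simp: king_def)
    moreover have "captured 3 ((!) s) ((!) s') r r' \<or> line_invariant s' r' \<and> ((s', r'), (s, r)) \<in> W"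
      if "r' \<in> board m n" "king r r'" for r'
    proof (cases "captured 3 ((!) s) ((!) s') r r'")
      case False
      obtain x' y' where r': "r' = (x', y')" by (cases r')
      have x': "x' = 0 \<or> x' = 1 \<or> x' = 2" and k: "\<bar>x - x'\<bar> \<le> 1" "\<bar>y - y'\<bar> \<le> 1"
        using that m unfolding r r' board_def king_def by auto
      have safe: "s' ! 0 \<noteq> r'" "s' ! 1 \<noteq> r'" "s' ! 2 \<noteq> r'"
        "s ! 0 = r' \<Longrightarrow> s' ! 0 \<noteq> r" "s ! 1 = r' \<Longrightarrow> s' ! 1 \<noteq> r" "s ! 2 = r' \<Longrightarrow> s' ! 2 \<noteq> r"
        using False unfolding captured_def ex_less_3 by auto
      consider (away) "y > j + 1" | (middle) "y = j + 1" "x = 1"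
        | (left) "y = j + 1" "x = 0" | (right) "y = j + 1" "x = 2"
        using j x by linarith
      then have "line_invariant s' r'"
      proof cases
        case away
        then have s': "s' = [(0, j + 1), (1, j + 1), (2, j + 1)]" by (simp add: s'_def)
        have "y' \<noteq> j + 1" using safe x' unfolding s' r' by auto
        then have "y' > j + 1" using away k by linarith
        then show ?thesis unfolding s' line_invariant_def r' by auto
      next
        case middle
        then have s': "s' = [(0, j), (1, j + 1), (2, j)]" by (simp add: s'_def)
        have "s = [(0, j), (1, j), (2, j)]" using s middle unfolding r by auto
        then have "y' \<noteq> j" using safe x' middle unfolding s' r r' by auto
        moreover have "r' \<noteq> (1, j + 1)" using safe unfolding s' by auto
        moreover have "j < y'" using calculation(1) middle k by linarith
        ultimately show ?thesis
          unfolding s' line_invariant_def by (intro exI[of _ j]) (simp add: r')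
      next
        case left
        then have s': "s' = [(0, j + 1), (1, j + 1), (1, j)]" by (simp add: s'_def)
        have "s ! 0 = (0, j)" using s left by auto
        then have "y' \<noteq> j \<and> y' \<noteq> j + 1" using safe x' left k unfolding s' r r' by auto
        then have "y' > j + 1" using left k by linarith
        then show ?thesis unfolding s' line_invariant_def r' by auto
      next
        case right
        then have s': "s' = [(1, j), (1, j + 1), (2, j + 1)]" by (simp add: s'_def)
        have "s ! 2 = (2, j)" using s right by auto
        then have "y' \<noteq> j \<and> y' \<noteq> j + 1" using safe x' right k unfolding s' r r' by auto
        then have "y' > j + 1" using right k by linarith
        then show ?thesis unfolding s' line_invariant_def r' by auto
      qed
      moreover have "((s', r'), (s, r)) \<in> W"
        using s x j y unfolding r W_def s'_def by auto
      ultimately show ?thesis by blast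
    qed blast
    ultimately show "\<exists>s'. (\<forall>i<3. king (s ! i) (s' ! i)) \<and>
        (\<forall>r'\<in>board m n. king r r' \<longrightarrow> captured 3 ((!) s) ((!) s') r r' \<or>
           line_invariant s' r' \<and> ((s', r'), (s, r)) \<in> W)" by blast
  qed
qed

section \<open>Four cops on an arbitrary board\<close>

text \<open>
  The first three cops form the line centred at \<open>(b, j)\<close>. They begin in the virtual row \<open>-1\<close>, which the robot
  cannot enter anyway, and stay there until the line has caught up with the robot's column;
  meanwhile it is to his left. The fourth cop may stand anywhere.
\<close>

definition guard_invariant :: "(int \<times> int) list \<Rightarrow> int \<times> int \<Rightarrow> bool" where
  "guard_invariant s r \<longleftrightarrow> (\<exists>b j d. s = [(b - 1, j), (b, j), (b + 1, j), d] \<and>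
     snd r > j \<and> b \<le> fst r + 1 \<and> (fst r \<le> b + 1 \<or> j = -1))"

lemma four_cops_win:
  assumes m: "0 < m" and n: "0 < n"
  shows "\<exists>\<sigma>. winning_cop_strategy (strong_grid m n) 4 \<sigma>"
proof -
  \<comment> \<open>The fourth cop is in the row above the line and to the left of the robot.\<close>
  define ready where
    "ready s r \<longleftrightarrow> snd (s ! 3) = snd (s ! 1) + 1 \<and> fst (s ! 3) < fst r"
    for s :: "(int \<times> int) list" and r :: "int \<times> int"
  \<comment> \<open>In order of priority: the line climbs; it catches up with the robot's column; the robot moves
    up and so lets it climb; the fourth cop gets ready; she moves right, or, while not ready,
    approaches the point at the left of the row above the line.\<close>
  define W where "W = measures
    [\<lambda>(s, r). nat (int n - snd (s ! 1)),
     \<lambda>(s, r). if fst (s ! 1) < fst r - 1 then nat (int m - fst (s ! 1)) else 0,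
     \<lambda>(s, r). if snd r > snd (s ! 1) + 1 then 0 else 1,
     \<lambda>(s, r). if ready s r then 0 else 1,
     \<lambda>(s, r). if ready s r then nat (int m - fst (s ! 3))
       else nat (max \<bar>fst (s ! 3) + 1\<bar> \<bar>snd (s ! 3) - (snd (s ! 1) + 1)\<bar>)]"
  let ?s0 = "[(-1, -1), (0, -1), (1, -1), (-1, -1)] :: (int \<times> int) list"
  show ?thesis
  proof (rule grid_strategy[where I = guard_invariant and ?s0.0 = ?s0 and W = W])
    show "0 < m" "0 < n" by fact+
    show "wf W" by (simp add: W_def)
    show "guard_invariant ?s0 r" if "r \<in> board m n" for r
      using that unfolding guard_invariant_def
      by (intro exI[of _ 0] exI[of _ "-1"] exI[of _ "(-1, -1)"]) (auto simp: board_def)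
  next
    fix s r assume inv: "guard_invariant s r" and rb: "r \<in> board m n"
    obtain x y where r: "r = (x, y)" by (cases r)
    have xy: "0 \<le> x" "x < int m" "0 \<le> y" "y < int n"
      using rb unfolding r board_def by auto
    obtain b j dx dy where s: "s = [(b - 1, j), (b, j), (b + 1, j), (dx, dy)]"
      and j: "y > j" and b: "b \<le> x + 1" "x \<le> b + 1 \<or> j = -1"
      using inv unfolding guard_invariant_def r fst_conv snd_conv by (metis surj_pair)
    \<comment> \<open>The line catches up with the robot's column before it ever climbs. When not ready, the fourth
      cop heads for \<open>(-1, j + 1)\<close>, where she is necessarily to the left of the robot.\<close>
    define b' where "b' = (if x \<le> b + 1 then x else b + 1)"
    define j' where "j' = (if x \<le> b + 1 \<and> y > j + 1 then j + 1 else j)"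
    define dx' where "dx' = (if ready s r then dx + 1 else dx - sgn (dx + 1))"
    define dy' where "dy' = dy - sgn (dy - (j + 1))"
    define s' where "s' = [(b' - 1, j'), (b', j'), (b' + 1, j'), (dx', dy')]"
    have sgn: "sgn z = 1 \<and> z > 0 \<or> sgn z = 0 \<and> z = 0 \<or> sgn z = -1 \<and> z < 0" for z :: int
      by (auto simp: sgn_if)
    have "\<bar>b - b'\<bar> \<le> 1" "\<bar>j - j'\<bar> \<le> 1" "\<bar>dx - dx'\<bar> \<le> 1" "\<bar>dy - dy'\<bar> \<le> 1"
      using b sgn[of "dx + 1"] sgn[of "dy - (j + 1)"] by (auto simp: b'_def j'_def dx'_def dy'_def)
    then have "\<forall>i<4. king (s ! i) (s' ! i)"
      unfolding all_less_4 s s'_def by (simp add: king_def)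
    moreover have "captured 4 ((!) s) ((!) s') r r' \<or> guard_invariant s' r' \<and> ((s', r'), (s, r)) \<in> W"
      if r'b: "r' \<in> board m n" and "king r r'" for r'
    proof (cases "captured 4 ((!) s) ((!) s') r r'")
      case False
      obtain x' y' where r': "r' = (x', y')" by (cases r')
      have xy': "0 \<le> x'" "x' < int m" "0 \<le> y'" "y' < int n"
        using r'b unfolding r' board_def by auto
      have k: "\<bar>x - x'\<bar> \<le> 1" "\<bar>y - y'\<bar> \<le> 1"
        using \<open>king r r'\<close> unfolding r r' king_def by auto
      have "s' ! 0 \<noteq> r'" "s' ! 1 \<noteq> r'" "s' ! 2 \<noteq> r'" "s' ! 3 \<noteq> r'"
        and swap: "s ! 3 = r' \<Longrightarrow> s' ! 3 \<noteq> r"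
        using False unfolding captured_def ex_less_4 by auto
      then have "y' = j' \<longrightarrow> x' \<noteq> b' - 1 \<and> x' \<noteq> b' \<and> x' \<noteq> b' + 1" and land: "(dx', dy') \<noteq> (x', y')"
        by (auto simp: s'_def r')
      then have line: "\<not> (\<bar>x' - b'\<bar> \<le> 1 \<and> y' = j')" by linarith
      have swap: "\<not> ((dx', dy') = (x, y) \<and> (dx, dy) = (x', y'))"
        using swap by (auto simp: s s'_def r r')
      have above: "y' > j'"
      proof (cases "x \<le> b + 1")
        case True
        then show ?thesis using line k j by (auto simp: b'_def j'_def split: if_splits)
      next
        case False
        then show ?thesis using b xy' by (auto simp: j'_def)
      qed
      have "guard_invariant s' r'"
        using above b k unfolding guard_invariant_def s'_def r'
        by (intro exI[of _ b'] exI[of _ j'] exI[of _ "(dx', dy')"]) (auto simp: b'_def j'_def)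
      moreover have "((s', r'), (s, r)) \<in> W"
      proof -
        consider (chase) "x > b + 1" | (climb) "x \<le> b + 1" "y > j + 1"
          | (up) "x \<le> b + 1" "y = j + 1" "y' > j + 1"
          | (push) "x \<le> b + 1" "y = j + 1" "y' = j + 1" "ready s r"
          | (prep) "x \<le> b + 1" "y = j + 1" "y' = j + 1" "\<not> ready s r"
          using j above by (fastforce simp: j'_def)
        then show ?thesis
        proof cases
          case chase
          then show ?thesis using xy k by (auto simp: W_def s s'_def r r' b'_def j'_def)
        next
          case climb
          then show ?thesis using xy by (auto simp: W_def s s'_def r r' b'_def j'_def)
        next
          case up
          then show ?thesis using k by (auto simp: W_def s s'_def r r' b'_def j'_def)
        next
          case push
          then have d: "dx' = dx + 1" "dy = j + 1" "dy' = j + 1" "dx < x"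
            by (auto simp: dx'_def dy'_def ready_def s r)
          \<comment> \<open>The robot cannot step onto the fourth cop, nor swap places with her.\<close>
          have "dx' < x'" using land swap k d push by auto
          then have "ready s' r'" using d push by (simp add: ready_def s'_def r' j'_def)
          then show ?thesis
            using push d xy k by (auto simp: W_def s s'_def r r' b'_def j'_def)
        next
          case prep
          then have "dx \<noteq> -1 \<or> dy \<noteq> j + 1" using xy by (auto simp: ready_def s r)
          then have "max \<bar>dx' + 1\<bar> \<bar>dy' - (j + 1)\<bar> < max \<bar>dx + 1\<bar> \<bar>dy - (j + 1)\<bar>"
            using prep sgn[of "dx + 1"] sgn[of "dy - (j + 1)"] by (auto simp: dx'_def dy'_def)
          moreover from this have "0 < max \<bar>dx + 1\<bar> \<bar>dy - (j + 1)\<bar>" by linarith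
          ultimately show ?thesis
            using prep k by (auto simp: W_def s s'_def r r' b'_def j'_def)
        qed
      qed
      ultimately show ?thesis by blast
    qed blast
    ultimately show "\<exists>s'. (\<forall>i<4. king (s ! i) (s' ! i)) \<and>
        (\<forall>r'\<in>board m n. king r r' \<longrightarrow> captured 4 ((!) s) ((!) s') r r' \<or>
           guard_invariant s' r' \<and> ((s', r'), (s, r)) \<in> W)" by blast
  qed
qed

section \<open>Evading cops\<close>

text \<open>
  The robot can stay in \<open>S\<close> for ever, since fewer vertices are closed to him than he can reach in \<open>S\<close>.
\<close>

lemma no_winning_cop_strategy:
  assumes G: "pair_graph G" and S: "S \<subseteq> pverts G" "S \<noteq> {}"
    and big: "\<And>v. v \<in> S \<Longrightarrow> k + 1 < card (closed_nbhd G v \<inter> S)"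
  shows "\<not> winning_cop_strategy G k \<sigma>"
proof
  assume win: "winning_cop_strategy G k \<sigma>"
  have escape: "\<exists>r'\<in>closed_nbhd G r \<inter> S. \<not> captured k c c' r r'" if "r \<in> S" for c c' :: "nat \<Rightarrow> 'a" and r
  proof -
    define f where "f i = (if c' i = r then c i else c' i)" for i
    \<comment> \<open>Each cop closes at most one vertex besides \<open>r\<close>.\<close>
    have "{r'. captured k c c' r r'} \<subseteq> insert r (f ` {..<k})"
      by (auto simp: captured_def f_def doubleton_eq_iff image_iff)
    moreover have "card (insert r (f ` {..<k})) \<le> k + 1"
      by (metis card_image_le card_insert_le_m1 card_lessThan diff_add_inverse2 finite_lessThan
          zero_less_Suc Suc_eq_plus1)
    ultimately have "card (insert r (f ` {..<k})) < card (closed_nbhd G r \<inter> S)"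
      using big[OF that] by linarith
    then have "\<not> closed_nbhd G r \<inter> S \<subseteq> insert r (f ` {..<k})"
      using card_mono[of "insert r (f ` {..<k})"] by (metis finite_imageI finite_insert finite_lessThan not_less)
    then show ?thesis
      using \<open>{r'. captured k c c' r r'} \<subseteq> insert r (f ` {..<k})\<close> by blast
  qed
  define esc where "esc c c' r = (SOME r'. r' \<in> closed_nbhd G r \<inter> S \<and> \<not> captured k c c' r r')"
    for c c' r
  have esc: "esc c c' r \<in> closed_nbhd G r \<inter> S \<and> \<not> captured k c c' r (esc c c' r)" if "r \<in> S" for c c' r
    unfolding esc_def by (rule someI_ex) (use escape[OF that] in blast)
  obtain r0 where r0: "r0 \<in> S" using S by blast
  \<comment> \<open>The robot's positions up to time \<open>t\<close>, oldest first.\<close>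
  define H where "H = rec_nat [r0]
    (\<lambda>_ h. h @ [esc (\<sigma> (butlast h)) (\<sigma> h) (last h)])"
  define R where "R t = last (H t)" for t
  have H_Suc: "H (Suc t) = H t @ [esc (\<sigma> (butlast (H t))) (\<sigma> (H t)) (last (H t))]" for t
    by (simp add: H_def)
  have H_R: "H t = map R [0..<Suc t]" for t
    by (induction t) (simp_all add: H_Suc R_def, simp add: H_def)
  have R_Suc: "R (Suc t) = esc (\<sigma> (map R [0..<t])) (\<sigma> (map R [0..<Suc t])) (R t)" for t
    unfolding R_def[of "Suc t"] H_Suc by (simp add: H_R)
  have RS: "R t \<in> S" for t
    by (induction t) (use r0 esc in \<open>simp_all add: R_Suc\<close>, simp add: R_def H_def)
  have "robot_play G R"
    unfolding robot_play_def using RS S esc by (auto simp: R_Suc)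
  then show False
    using win esc[OF RS] unfolding winning_cop_strategy_def by (metis R_Suc)
qed

lemma closed_nbhd_strong_product:
  assumes "g \<in> pverts G" "h \<in> pverts H" "pair_graph G" "pair_graph H"
  shows "closed_nbhd (strong_product G H) (g, h) = closed_nbhd G g \<times> closed_nbhd H h"
  using assms closed_nbhd_subset_verts[OF assms(3,1)] closed_nbhd_subset_verts[OF assms(4,2)]
  by (auto simp: closed_nbhd_def strong_product_def)

lemma closed_nbhd_path_graph:
  "a < n \<Longrightarrow> closed_nbhd (path_graph n) a = {a - 1..min (Suc a) (n - 1)}"
  by (auto simp: closed_nbhd_def path_graph_def)

lemma card_closed_nbhd_path_graph:
  assumes "a < n" "2 \<le> n"
  shows "card (closed_nbhd (path_graph n) a) = (if a = 0 \<or> a = n - 1 then 2 else 3)"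
  unfolding closed_nbhd_path_graph[OF assms(1)] using assms by (auto simp: min_def)

lemma card_closed_nbhd_strong_grid:
  assumes "a < m" "b < n"
  shows "card (closed_nbhd (strong_grid m n) (a, b)) =
    card (closed_nbhd (path_graph m) a) * card (closed_nbhd (path_graph n) b)"
  using assms by (simp add: closed_nbhd_strong_product pair_graph_path_graph pverts_path_graph
      card_cartesian_product)

lemma two_cops_lose:
  assumes "2 \<le> m" "2 \<le> n" "k \<le> 2"
  shows "\<not> winning_cop_strategy (strong_grid m n) k \<sigma>"
proof (rule no_winning_cop_strategy[OF pair_graph_strong_grid order_refl])
  show "pverts (strong_grid m n) \<noteq> {}" using assms by (auto simp: pverts_strong_grid lessThan_empty_iff)
next
  fix v assume v: "v \<in> pverts (strong_grid m n)"
  then obtain a b where ab: "v = (a, b)" "a < m" "b < n" by (auto simp: pverts_strong_grid)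
  have "closed_nbhd (strong_grid m n) v \<inter> pverts (strong_grid m n) = closed_nbhd (strong_grid m n) v"
    using closed_nbhd_subset_verts[OF pair_graph_strong_grid v] by blast
  moreover have "card (closed_nbhd (strong_grid m n) v) \<ge> 4"
    unfolding ab(1) card_closed_nbhd_strong_grid[OF ab(2,3)]
    using ab assms by (simp add: card_closed_nbhd_path_graph)
  ultimately show "k + 1 < card (closed_nbhd (strong_grid m n) v \<inter> pverts (strong_grid m n))"
    using assms by simp
qed

text \<open>
  The robot avoids the corners. A closed neighbourhood contains at most one corner, because
  opposite sides are at distance at least 3.
\<close>

lemma three_cops_lose:
  assumes mn: "4 \<le> m" "4 \<le> n" and k: "k \<le> 3"
  shows "\<not> winning_cop_strategy (strong_grid m n) k \<sigma>"
proof (rule no_winning_cop_strategy[OF pair_graph_strong_grid])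
  let ?C = "{0, m - 1} \<times> {0, n - 1}"
  let ?S = "pverts (strong_grid m n) - ?C"
  show "?S \<subseteq> pverts (strong_grid m n)" by blast
  have "(1, 1) \<in> ?S" using mn by (auto simp: pverts_strong_grid)
  then show "?S \<noteq> {}" by blast
  fix v assume v: "v \<in> ?S"
  then obtain a b where ab: "v = (a, b)" "a < m" "b < n" by (auto simp: pverts_strong_grid)
  let ?N = "closed_nbhd (strong_grid m n) v"
  let ?A = "closed_nbhd (path_graph m) a" and ?B = "closed_nbhd (path_graph n) b"
  have N: "?N = ?A \<times> ?B"
    using ab by (simp add: closed_nbhd_strong_product pair_graph_path_graph pverts_path_graph)
  have ends: "card ({0, l - 1} \<inter> closed_nbhd (path_graph l) c) \<le> 1" if "c < l" "4 \<le> l" for c l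
    unfolding closed_nbhd_path_graph[OF that(1)] using that by (auto simp: card_le_Suc0_iff_eq)
  have "?C \<inter> ?N = ({0, m - 1} \<inter> ?A) \<times> ({0, n - 1} \<inter> ?B)" unfolding N by blast
  then have "card (?C \<inter> ?N) \<le> 1"
    using mult_le_mono[OF ends[OF ab(2) mn(1)] ends[OF ab(3) mn(2)]]
    by (simp add: card_cartesian_product)
  moreover have "card ?N \<ge> 6"
    unfolding ab(1) card_closed_nbhd_strong_grid[OF ab(2,3)]
    using v ab mn by (auto simp: card_closed_nbhd_path_graph)
  moreover have "?N \<inter> ?S = ?N - ?C \<inter> ?N"
    using closed_nbhd_subset_verts[OF pair_graph_strong_grid, of v] v by blast
  then have "card (?N \<inter> ?S) = card (?N - ?C \<inter> ?N)"
    by (rule arg_cong)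
  moreover have "card ?N \<le> card (?N - ?C \<inter> ?N) + card (?C \<inter> ?N)"
    using diff_card_le_card_Diff[of "?C \<inter> ?N" ?N] by (simp add: le_diff_conv)
  ultimately show "k + 1 < card (?N \<inter> ?S)" using k by linarith
qed

section \<open>The cop numbers\<close>

text \<open>
  The cops play the mirror image of their strategy against the mirror image of the robot.
\<close>

lemma winning_cop_strategy_swap:
  assumes G: "pair_graph G" and H: "pair_graph H"
    and win: "winning_cop_strategy (strong_product G H) k \<sigma>"
  shows "winning_cop_strategy (strong_product H G) k (\<lambda>h. prod.swap \<circ> \<sigma> (map prod.swap h))"
proof -
  have nbhd: "prod.swap w \<in> closed_nbhd (strong_product G H) (prod.swap v) \<longleftrightarrow>
      w \<in> closed_nbhd (strong_product H G) v" for v w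
    by (cases v; cases w) (auto simp: closed_nbhd_def strong_product_def)
  have nbhd': "prod.swap w \<in> closed_nbhd (strong_product H G) (prod.swap v) \<longleftrightarrow>
      w \<in> closed_nbhd (strong_product G H) v" for v w
    by (cases v; cases w) (auto simp: closed_nbhd_def strong_product_def)
  have verts: "prod.swap v \<in> pverts (strong_product G H) \<longleftrightarrow> v \<in> pverts (strong_product H G)" for v
    by (cases v) (auto simp: strong_product_def)
  have verts': "prod.swap v \<in> pverts (strong_product H G) \<longleftrightarrow> v \<in> pverts (strong_product G H)" for v
    by (cases v) (auto simp: strong_product_def)
  have cap: "captured k (prod.swap \<circ> c) (prod.swap \<circ> c') r r' \<longleftrightarrow>
      captured k c c' (prod.swap r) (prod.swap r')" for c c' :: "nat \<Rightarrow> 'a \<times> 'b" and r r'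
    by (cases r; cases r') (auto simp: captured_def doubleton_eq_iff prod_eq_iff)
  have "\<exists>t. captured k (prod.swap \<circ> \<sigma> (map prod.swap (map R [0..<t])))
      (prod.swap \<circ> \<sigma> (map prod.swap (map R [0..<Suc t]))) (R t) (R (Suc t))"
    if "robot_play (strong_product H G) R" for R
  proof -
    have "robot_play (strong_product G H) (prod.swap \<circ> R)"
      using that by (simp add: robot_play_def nbhd verts)
    then obtain t where "captured k (\<sigma> (map (prod.swap \<circ> R) [0..<t]))
        (\<sigma> (map (prod.swap \<circ> R) [0..<Suc t])) ((prod.swap \<circ> R) t) ((prod.swap \<circ> R) (Suc t))"
      using win unfolding winning_cop_strategy_def by blast
    then show ?thesis unfolding cap map_map by (metis comp_apply)
  qed
  moreover have "cop_strategy (strong_product H G) k (\<lambda>h. prod.swap \<circ> \<sigma> (map prod.swap h))"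
    using win by (simp add: winning_cop_strategy_def cop_strategy_def nbhd' verts')
  ultimately show ?thesis unfolding winning_cop_strategy_def by blast
qed

lemma c_cr_eqI:
  assumes "\<exists>\<sigma>. winning_cop_strategy G k \<sigma>"
    and "\<And>l \<sigma>. l < k \<Longrightarrow> \<not> winning_cop_strategy G l \<sigma>"
  shows "c_cr G = k"
  unfolding c_cr_def using assms by (intro Least_equality) (auto simp: not_less[symmetric])

theorem theorem5p2:
  fixes m n :: nat
  shows "(m > 3 \<and> n > 3 \<longrightarrow>
            c_cr (strong_product (path_graph m) (path_graph n)) = 4) \<and>
         (min m n = 2 \<or> min m n = 3 \<longrightarrow>
            c_cr (strong_product (path_graph m) (path_graph n)) = 3)"
proof (intro conjI impI)
  assume "m > 3 \<and> n > 3"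
  then show "c_cr (strong_grid m n) = 4"
    by (intro c_cr_eqI four_cops_win three_cops_lose) auto
next
  assume mn: "min m n = 2 \<or> min m n = 3"
  have "\<exists>\<sigma>. winning_cop_strategy (strong_grid m n) 3 \<sigma>"
  proof (cases "m \<le> 3")
    case True
    then show ?thesis using mn by (intro three_cops_win) auto
  next
    case False
    then have "\<exists>\<sigma>. winning_cop_strategy (strong_grid n m) 3 \<sigma>"
      using mn by (intro three_cops_win) auto
    then show ?thesis
      using winning_cop_strategy_swap[OF pair_graph_path_graph pair_graph_path_graph] by blast
  qed
  then show "c_cr (strong_grid m n) = 3"
    using mn by (intro c_cr_eqI two_cops_lose) auto
qed

end
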